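(* Consider the problem $\phi^*:=\min_{x\in X}\{\phi(x):=f(x)+h(x)\}$, with the Lipschitz constants $L$ (for $f$) and $M$ (for $h$) satisfying $M\ge L$. Suppose that the parameters of the AGS algorithm are set to $$\gamma_k=\frac{2}{k+1},\quad T_k\equiv T:=\left\lceil\sqrt{\frac{M}{L}}\right\rceil,\quad \lambda_k=\begin{cases}1,&k=1,\\ \dfrac{\gamma_k(T+1)(T+2)}{T(T+3)},&k>1,\end{cases}\quad\text{and}\quad \beta_k=\frac{3L\gamma_k}{\nu k\lambda_k}.$$ Also assume that the parameters in the first call to the ProxAG procedure ($k=1$) are set to $$\alpha_t=\frac{2}{t+1},\quad p_t=\frac{t-1}{2},\quad q_t=\frac{6M}{\nu t},$$ and the parameters in the remaining calls to the ProxAG procedure ($k>1$) are set to $$\alpha_t=\frac{2}{t+2},\quad p_t=\frac{t}{2},\quad q_t=\frac{6M}{\nu k(t+1)}.$$ Then the numbers of gradient evaluations of $\nabla f$ and $\nabla h$ performed by the AGS algorithm to compute an $\varepsilon$-solution of $\min_{x\in X}\phi(x)$ can be bounded by $$N_f:=\sqrt{\frac{30LV(x_0,x^* )}{\nu\varepsilon}}$$ and $$N_h:=\sqrt{\frac{30MV(x_0,x^* )}{\nu\varepsilon}}+\sqrt{\frac{30LV(x_0,x^* )}{\nu\varepsilon}},$$ respectively, where $x^*$ is a solution to $\min_{x\in X}\phi(x)$.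
   Context: Setting. $\|\cdot\|$ is a norm and $\langle\cdot,\cdot\rangle$ the inner product on $\mathbb{R}^n$; $X\subseteq\mathbb{R}^n$ is a closed convex set. $f,h:X\to\mathbb{R}$ are continuously differentiable convex functions and $L,M>0$ are such that, with $l_f(u,x):=f(u)+\langle\nabla f(u),x-u\rangle$ and $l_h(u,x):=h(u)+\langle\nabla h(u),x-u\rangle$, $$0\le f(x)-l_f(u,x)\le\tfrac{L}{2}\|x-u\|^2,\qquad 0\le h(x)-l_h(u,x)\le\tfrac{M}{2}\|x-u\|^2,\qquad\forall x,u\in X.$$ For $\varepsilon>0$, an $\varepsilon$-solution of $\min_{x\in X}\phi(x)$ is a point $\bar x\in X$ with $\phi(\bar x)-\phi^*\le\varepsilon$. Prox-function. $V$ is a prox-function on $X$ with modulus $\nu>0$: there is a (differentiable) function $\pi$, strongly convex with parameter $\nu$ with respect to $\|\cdot\|$, such that $V(x,u)=\pi(u)-\pi(x)-\langle\nabla\pi(x),u-x\rangle$ for $x,u\in X$. Hence $V(x,u)\ge\frac{\nu}{2}\|x-u\|^2$. AGS (accelerated gradient sliding) algorithm. Choose $x_0\in X$ and set $\overline{x}_0=x_0$. For $k=1,\dots,N$: $$\underline{x}_k=(1-\gamma_k)\overline{x}_{k-1}+\gamma_kx_{k-1},\quad g_k(\cdot)=l_f(\underline{x}_k,\cdot),$$ $$(x_k,\tilde x_k)=\mathrm{ProxAG}(g_k,\overline{x}_{k-1},x_{k-1},\lambda_k,\beta_k,T_k),\quad \overline{x}_k=(1-\lambda_k)\overline{x}_{k-1}+\lambda_k\tilde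 x_k.$$ Output $\overline{x}_N$. Procedure $(x^+,\tilde x^+)=\mathrm{ProxAG}(g,\overline{x},x,\lambda,\beta,T)$: set $\tilde u_0=\overline{x}$, $u_0=x$. For $t=1,\dots,T$: $$\underline{u}_t=(1-\lambda)\overline{x}+\lambda(1-\alpha_t)\tilde u_{t-1}+\lambda\alpha_tu_{t-1},$$ $$u_t=\operatorname*{argmin}_{u\in X}\ g(u)+l_h(\underline{u}_t,u)+\beta V(x,u)+(\beta p_t+q_t)V(u_{t-1},u),$$ $$\tilde u_t=(1-\alpha_t)\tilde u_{t-1}+\alpha_tu_t.$$ Output $x^+=u_T$, $\tilde x^+=\tilde u_T$. The parameters $\alpha_t,p_t,q_t$ may depend on the index $k$ of the call. Counting. Each outer iteration $k$ (one call to ProxAG) uses one evaluation of $\nabla f$ (at $\underline{x}_k$); each inner iteration $t$ uses one evaluation of $\nabla h$ (at $\underline{u}_t$) and none of $\nabla f$.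
   Formalization: Since evaluation counts are integers, the bounds are proved as ⌈N_f⌉ for ∇f and N_h + (⌈N_f⌉ − N_f)T for ∇h; also, every output after at least N_f evaluations of ∇f, or at least N_h of ∇h, is an ε-solution. The unrounded bounds fail, e.g. when N_f < 1 and x_0 is not an ε-solution. *)

theory Defs
  imports "HOL-Analysis.Analysis"
begin

text \<open>The norm measuring smoothness and strong convexity is arbitrary; it need not be the one
  induced by the inner product.\<close>

definition is_norm :: "('a::real_vector \<Rightarrow> real) \<Rightarrow> bool" where
  "is_norm nrm \<longleftrightarrow>
     (\<forall>x. nrm x = 0 \<longleftrightarrow> x = 0) \<and>
     (\<forall>c x. nrm (c *\<^sub>R x) = \<bar>c\<bar> * nrm x) \<and>
     (\<forall>x y. nrm (x + y) \<le> nrm x + nrm y)"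

text \<open>Derivatives are taken within \<open>X\<close>, since functions are only meant to be given on \<open>X\<close>. If
  \<open>X\<close> has empty interior the gradient is not unique, and \<open>f'\<close> is any choice of it.\<close>

definition has_gradient_on ::
  "('a::euclidean_space \<Rightarrow> real) \<Rightarrow> ('a \<Rightarrow> 'a) \<Rightarrow> 'a set \<Rightarrow> bool" where
  "has_gradient_on f f' X \<longleftrightarrow>
     (\<forall>x\<in>X. (f has_derivative (\<lambda>d. f' x \<bullet> d)) (at x within X))"

definition lin_approx ::
  "('a::euclidean_space \<Rightarrow> real) \<Rightarrow> ('a \<Rightarrow> 'a) \<Rightarrow> 'a \<Rightarrow> 'a \<Rightarrow> real" where
  "lin_approx f f' u x = f u + f' u \<bullet> (x - u)"

definition strongly_convex_on ::
  "'a::real_vector set \<Rightarrow> ('a \<Rightarrow> real) \<Rightarrow> real \<Rightarrow> ('a \<Rightarrow> real) \<Rightarrow> bool" where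
  "strongly_convex_on X nrm \<nu> \<pi> \<longleftrightarrow>
     convex X \<and>
     (\<forall>x\<in>X. \<forall>y\<in>X. \<forall>t\<in>{0..1}.
        \<pi> ((1 - t) *\<^sub>R x + t *\<^sub>R y)
          \<le> (1 - t) * \<pi> x + t * \<pi> y - \<nu> / 2 * t * (1 - t) * (nrm (x - y))\<^sup>2)"

definition prox_function ::
  "'a::euclidean_space set \<Rightarrow> ('a \<Rightarrow> real) \<Rightarrow> real \<Rightarrow> ('a \<Rightarrow> 'a \<Rightarrow> real) \<Rightarrow> bool" where
  "prox_function X nrm \<nu> V \<longleftrightarrow>
     \<nu> > 0 \<and>
     (\<exists>\<pi> \<pi>'. has_gradient_on \<pi> \<pi>' X \<and> strongly_convex_on X nrm \<nu> \<pi> \<and>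
        (\<forall>x\<in>X. \<forall>u\<in>X. V x u = \<pi> u - \<pi> x - \<pi>' x \<bullet> (u - x)))"

definition eps_solution :: "'a set \<Rightarrow> ('a \<Rightarrow> real) \<Rightarrow> real \<Rightarrow> 'a \<Rightarrow> bool" where
  "eps_solution X \<phi> \<epsilon> x \<longleftrightarrow> x \<in> X \<and> \<phi> x - (INF y\<in>X. \<phi> y) \<le> \<epsilon>"

text \<open>The state after \<open>t\<close> inner iterations is \<open>(u\<^sub>t, \<tilde>u\<^sub>t, c)\<close>, where \<open>c\<close> is the number of
  evaluations of \<open>h'\<close> made so far. One inner iteration evaluates \<open>h'\<close> once, at \<open>ul\<close>: the
  function minimized over \<open>v\<close> involves \<open>h'\<close> only through the value \<open>h' ul\<close>.\<close>

primrec prox_ag ::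
  "'a::euclidean_space set \<Rightarrow> ('a \<Rightarrow> real) \<Rightarrow> ('a \<Rightarrow> 'a) \<Rightarrow> ('a \<Rightarrow> 'a \<Rightarrow> real) \<Rightarrow>
   (nat \<Rightarrow> real) \<Rightarrow> (nat \<Rightarrow> real) \<Rightarrow> (nat \<Rightarrow> real) \<Rightarrow>
   ('a \<Rightarrow> real) \<Rightarrow> 'a \<Rightarrow> 'a \<Rightarrow> real \<Rightarrow> real \<Rightarrow> nat \<Rightarrow> 'a \<times> 'a \<times> nat" where
  "prox_ag X h h' V \<alpha> p q g xb x lam \<beta> 0 = (x, xb, 0)"
| "prox_ag X h h' V \<alpha> p q g xb x lam \<beta> (Suc t) =
     (let (u, ut, c) = prox_ag X h h' V \<alpha> p q g xb x lam \<beta> t;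
          a = \<alpha> (Suc t);
          ul = (1 - lam) *\<^sub>R xb + (lam * (1 - a)) *\<^sub>R ut + (lam * a) *\<^sub>R u;
          u_new = arg_min_on
            (\<lambda>v. g v + lin_approx h h' ul v + \<beta> * V x v
                   + (\<beta> * p (Suc t) + q (Suc t)) * V u v) X
      in (u_new, (1 - a) *\<^sub>R ut + a *\<^sub>R u_new, c + 1))"

text \<open>The state after \<open>k\<close> outer iterations is \<open>(x\<^sub>k, xb\<^sub>k, cf, ch)\<close>, where \<open>xb\<^sub>k\<close> is the
  averaged iterate and \<open>cf\<close>, \<open>ch\<close> are the numbers of evaluations of \<open>f'\<close> and \<open>h'\<close> made so far.
  The first argument of \<open>\<alpha>\<close>, \<open>p\<close>, \<open>q\<close> is the outer index.\<close>

primrec ags ::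
  "'a::euclidean_space set \<Rightarrow> ('a \<Rightarrow> real) \<Rightarrow> ('a \<Rightarrow> 'a) \<Rightarrow> ('a \<Rightarrow> real) \<Rightarrow> ('a \<Rightarrow> 'a) \<Rightarrow>
   ('a \<Rightarrow> 'a \<Rightarrow> real) \<Rightarrow>
   (nat \<Rightarrow> real) \<Rightarrow> (nat \<Rightarrow> real) \<Rightarrow> (nat \<Rightarrow> real) \<Rightarrow> (nat \<Rightarrow> nat) \<Rightarrow>
   (nat \<Rightarrow> nat \<Rightarrow> real) \<Rightarrow> (nat \<Rightarrow> nat \<Rightarrow> real) \<Rightarrow> (nat \<Rightarrow> nat \<Rightarrow> real) \<Rightarrow>
   'a \<Rightarrow> nat \<Rightarrow> 'a \<times> 'a \<times> nat \<times> nat" where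
  "ags X f f' h h' V \<gamma> lam \<beta> T \<alpha> p q x0 0 = (x0, x0, 0, 0)"
| "ags X f f' h h' V \<gamma> lam \<beta> T \<alpha> p q x0 (Suc j) =
     (let (x, xb, cf, ch) = ags X f f' h h' V \<gamma> lam \<beta> T \<alpha> p q x0 j;
          k = Suc j;
          xl = (1 - \<gamma> k) *\<^sub>R xb + \<gamma> k *\<^sub>R x;
          (x_new, xt, c) = prox_ag X h h' V (\<alpha> k) (p k) (q k)
            (lin_approx f f' xl) xb x (lam k) (\<beta> k) (T k)
      in (x_new, (1 - lam k) *\<^sub>R xb + lam k *\<^sub>R xt, cf + 1, ch + c))"

end

theory Submission
  imports Defs
begin

text \<open>With \<open>g\<close> the linearisation of \<open>f\<close>, one inner iteration is an accelerated gradient step for \<open>g + h\<close>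
  at the points \<open>w\<^sub>t = (1 - \<lambda>) xb + \<lambda> \<tilde>u\<^sub>t\<close>. Multiplied by weights \<open>W\<^sub>t\<close>, \<open>W\<^sub>t = t (t + 1)\<close> in the first
  call and \<open>W\<^sub>t = (t + 1) (t + 2)\<close> later, the per-step inequalities telescope. The terms \<open>V(x, u\<^sub>t)\<close>
  left over by the prox centre \<open>x\<close> absorb the linearisation error of \<open>f\<close>, because
  \<open>xb\<^sub>k - xl\<^sub>k = \<gamma>\<^sub>k (v - x)\<close> for a weighted average \<open>v\<close> of the \<open>u\<^sub>t\<close>. One outer iteration thus gives
  \<open>\<phi>(xb\<^sub>k) - \<phi>\<^sup>* \<le> (1 - \<gamma>\<^sub>k) (\<phi>(xb\<^sub>k\<^sub>-\<^sub>1) - \<phi>\<^sup>*) + \<eta>\<^sub>k (V(x\<^sub>k\<^sub>-\<^sub>1, x\<^sup>*) - V(x\<^sub>k, x\<^sup>*))\<close>, where \<open>k (k + 1) \<eta>\<^sub>k\<close> is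
  constant for \<open>k > 1\<close>, and at \<open>k = 1\<close> at least that constant and at most \<open>30 L / \<nu>\<close>. Summation yields
  \<open>N (N + 1) (\<phi>(xb\<^sub>N) - \<phi>\<^sup>*) \<le> 30 L V(x\<^sub>0, x\<^sup>*) / \<nu>\<close>, and \<open>evals_h = N T\<close> with \<open>T \<le> \<surd>(M/L) + 1\<close>.\<close>

section \<open>Arbitrary norms on a Euclidean space\<close>

lemma is_norm_sum_le:
  assumes "is_norm nrm" "finite I"
  shows "nrm (\<Sum>i\<in>I. f i) \<le> (\<Sum>i\<in>I. nrm (f i))"
  using assms(2)
proof (induction I rule: finite_induct)
  case empty
  have "nrm 0 = 0" using assms(1) unfolding is_norm_def by blast
  then show ?case by simp
next
  case (insert i I)
  have "nrm (f i + sum f I) \<le> nrm (f i) + nrm (sum f I)"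
    using assms(1) by (auto simp: is_norm_def)
  with insert show ?case by simp
qed

lemma is_norm_minus: "is_norm nrm \<Longrightarrow> nrm (- x) = nrm x"
  unfolding is_norm_def by (metis abs_minus_cancel abs_one mult_1 scaleR_minus1_left)

lemma is_norm_nonneg:
  assumes "is_norm nrm"
  shows "0 \<le> nrm x"
proof -
  have "nrm (x + - x) \<le> nrm x + nrm (- x)" "nrm 0 = 0"
    using assms unfolding is_norm_def by blast+
  then show ?thesis by (simp add: is_norm_minus[OF assms])
qed

text \<open>Half of the equivalence of norms: \<open>nrm\<close> is Lipschitz, so it attains its
  minimum on the compact Euclidean unit sphere, and that minimum is positive. This turns growth
  measured in \<open>nrm\<close> into Euclidean coercivity.\<close>

lemma is_norm_bounded_below:
  fixes nrm :: "'a::euclidean_space \<Rightarrow> real"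
  assumes n: "is_norm nrm"
  obtains \<kappa> where "\<kappa> > 0" "\<And>x. \<kappa> * norm x \<le> nrm x"
proof -
  have scale: "nrm (c *\<^sub>R x) = \<bar>c\<bar> * nrm x" and zero: "nrm x = 0 \<longleftrightarrow> x = 0"
    and tri: "nrm (x + y) \<le> nrm x + nrm y" for c x y
    using n by (auto simp: is_norm_def)
  define K where "K = (\<Sum>b\<in>Basis. nrm (b::'a))"
  have K: "nrm x \<le> K * norm x" for x
  proof -
    have "nrm x = nrm (\<Sum>b\<in>Basis. (x \<bullet> b) *\<^sub>R b)"
      by (simp add: euclidean_representation)
    also have "\<dots> \<le> (\<Sum>b\<in>Basis. nrm ((x \<bullet> b) *\<^sub>R b))"
      by (rule is_norm_sum_le[OF n]) simp
    also have "\<dots> \<le> (\<Sum>b\<in>Basis. norm x * nrm b)"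
      by (intro sum_mono) (auto simp: scale Basis_le_norm intro!: mult_right_mono is_norm_nonneg[OF n])
    finally show ?thesis by (simp add: K_def sum_distrib_left mult.commute)
  qed
  have "K-lipschitz_on UNIV nrm"
  proof (rule lipschitz_onI)
    fix x y :: 'a
    have "nrm x \<le> nrm (x - y) + nrm y" "nrm y \<le> nrm (y - x) + nrm x"
      using tri[of "x - y" y] tri[of "y - x" x] by auto
    then show "dist (nrm x) (nrm y) \<le> K * dist x y"
      using K[of "x - y"] K[of "y - x"] by (auto simp: dist_norm norm_minus_commute)
  qed (simp add: K_def sum_nonneg is_norm_nonneg[OF n])
  then have cont: "continuous_on (sphere 0 1) nrm"
    using lipschitz_on_continuous_on continuous_on_subset by blast
  obtain b :: 'a where "b \<in> Basis" using nonempty_Basis by blast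
  then have "sphere (0::'a) 1 \<noteq> {}" by (auto intro!: exI[of _ b])
  from continuous_attains_inf[OF compact_sphere this cont]
  obtain s where s: "s \<in> sphere (0::'a) 1" "\<And>y. y \<in> sphere 0 1 \<Longrightarrow> nrm s \<le> nrm y"
    by blast
  show thesis
  proof
    have "s \<noteq> 0" using s(1) by auto
    then show "nrm s > 0" using zero[of s] is_norm_nonneg[OF n, of s] by auto
    show "nrm s * norm x \<le> nrm x" for x
    proof (cases "x = 0")
      case False
      have "nrm s \<le> nrm (inverse (norm x) *\<^sub>R x)"
        by (rule s(2)) (use False in simp)
      then show ?thesis using False by (simp add: scale field_simps)
    qed (simp add: zero[THEN iffD2])
  qed
qed

section \<open>Gradients within a convex set, prox-functions and proximal minimisation\<close>

lemma has_gradient_on_directional: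
  assumes "has_gradient_on f f' X" "convex X" "x \<in> X" "y \<in> X"
  shows "((\<lambda>t. (f (x + t *\<^sub>R (y - x)) - f x) / t) \<longlongrightarrow> f' x \<bullet> (y - x)) (at_right 0)"
proof -
  \<comment> \<open>Convexity keeps the segment from \<open>x\<close> to \<open>y\<close> in
    \<open>X\<close>; composing with its parametrisation turns the derivative within
    \<open>X\<close> into a one-sided derivative on the line, even if \<open>X\<close> has empty
    interior.\<close>
  have sub: "(\<lambda>t. x + t *\<^sub>R (y - x)) ` {0..1} \<subseteq> X"
  proof safe
    fix t :: real assume "t \<in> {0..1}"
    then have "(1 - t) *\<^sub>R x + t *\<^sub>R y \<in> X"
      using assms by (auto intro: convexD)
    then show "x + t *\<^sub>R (y - x) \<in> X" by (simp add: algebra_simps)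
  qed
  have "(f has_derivative (\<lambda>d. f' x \<bullet> d)) (at x within X)"
    using assms by (auto simp: has_gradient_on_def)
  then have "(f has_derivative (\<lambda>d. f' x \<bullet> d))
      (at (x + 0 *\<^sub>R (y - x)) within (\<lambda>t. x + t *\<^sub>R (y - x)) ` {0..1})"
    using has_derivative_subset[OF _ sub] by simp
  moreover have "((\<lambda>t. x + t *\<^sub>R (y - x)) has_derivative (\<lambda>t. t *\<^sub>R (y - x))) (at 0 within {0..1})"
    by (auto intro!: derivative_eq_intros)
  ultimately have "((\<lambda>t. f (x + t *\<^sub>R (y - x))) has_derivative (\<lambda>t. f' x \<bullet> (t *\<^sub>R (y - x))))
      (at 0 within {0..1})"
    using has_derivative_in_compose[of "\<lambda>t. x + t *\<^sub>R (y - x)" _ 0 "{0..1}" f] by blast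
  then have "((\<lambda>t. f (x + t *\<^sub>R (y - x))) has_field_derivative (f' x \<bullet> (y - x))) (at_right 0)"
    by (simp add: has_field_derivative_def at_within_Icc_at_right mult_commute_abs)
  then show ?thesis by (simp add: has_field_derivative_iff)
qed

text \<open>Divide the strong convexity inequality by \<open>t\<close> and let \<open>t\<close> tend
  to 0 from the right.\<close>

lemma strongly_convex_on_gradient_le:
  assumes grad: "has_gradient_on \<pi> \<pi>' X" and sc: "strongly_convex_on X nrm \<nu> \<pi>"
    and xy: "x \<in> X" "y \<in> X"
  shows "\<nu> / 2 * (nrm (x - y))\<^sup>2 \<le> \<pi> y - \<pi> x - \<pi>' x \<bullet> (y - x)"
proof -
  have cX: "convex X" using sc by (simp add: strongly_convex_on_def)
  have "((\<lambda>t. \<pi> y - \<pi> x - \<nu> / 2 * (1 - t) * (nrm (x - y))\<^sup>2) \<longlongrightarrow>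
      \<pi> y - \<pi> x - \<nu> / 2 * (1 - 0) * (nrm (x - y))\<^sup>2) (at_right 0)"
    by (intro tendsto_intros)
  moreover have "\<forall>\<^sub>F t in at_right 0. (\<pi> (x + t *\<^sub>R (y - x)) - \<pi> x) / t
      \<le> \<pi> y - \<pi> x - \<nu> / 2 * (1 - t) * (nrm (x - y))\<^sup>2"
  proof (rule eventually_at_rightI)
    fix t :: real assume t: "t \<in> {0<..<1}"
    then have "\<pi> ((1 - t) *\<^sub>R x + t *\<^sub>R y)
        \<le> (1 - t) * \<pi> x + t * \<pi> y - \<nu> / 2 * t * (1 - t) * (nrm (x - y))\<^sup>2"
      using sc xy by (auto simp: strongly_convex_on_def)
    moreover have "(1 - t) *\<^sub>R x + t *\<^sub>R y = x + t *\<^sub>R (y - x)" by (simp add: algebra_simps)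
    ultimately have "\<pi> (x + t *\<^sub>R (y - x)) - \<pi> x
        \<le> t * (\<pi> y - \<pi> x - \<nu> / 2 * (1 - t) * (nrm (x - y))\<^sup>2)"
      by (simp add: algebra_simps)
    then show "(\<pi> (x + t *\<^sub>R (y - x)) - \<pi> x) / t
        \<le> \<pi> y - \<pi> x - \<nu> / 2 * (1 - t) * (nrm (x - y))\<^sup>2"
      using t by (simp add: divide_le_eq mult.commute)
  qed simp
  ultimately have "\<pi>' x \<bullet> (y - x) \<le> \<pi> y - \<pi> x - \<nu> / 2 * (1 - 0) * (nrm (x - y))\<^sup>2"
    by (rule tendsto_le[OF trivial_limit_at_right_real _ has_gradient_on_directional[OF grad cX xy]])
  then show ?thesis by simp
qed

lemma prox_function_ge:
  assumes "prox_function X nrm \<nu> V" "x \<in> X" "u \<in> X"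
  shows "\<nu> / 2 * (nrm (x - u))\<^sup>2 \<le> V x u"
  using assms strongly_convex_on_gradient_le unfolding prox_function_def by fastforce

text \<open>Difference quotients of \<open>F\<close> from a minimiser along a segment in
  \<open>X\<close> are nonnegative, hence so is their limit.\<close>

lemma has_gradient_on_arg_min:
  assumes "has_gradient_on F F' X" "convex X" "is_arg_min F (\<lambda>x. x \<in> X) u" "v \<in> X"
  shows "0 \<le> F' u \<bullet> (v - u)"
proof -
  have u: "u \<in> X" "F u \<le> F y" if "y \<in> X" for y
    using assms(3) that by (auto simp: is_arg_min_linorder)
  have "\<forall>\<^sub>F t in at_right 0. 0 \<le> (F (u + t *\<^sub>R (v - u)) - F u) / t"
  proof (rule eventually_at_rightI)
    fix t :: real assume t: "t \<in> {0<..<1}"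
    have "(1 - t) *\<^sub>R u + t *\<^sub>R v \<in> X"
      using t assms u by (auto intro: convexD)
    then have "F u \<le> F (u + t *\<^sub>R (v - u))" by (intro u(2)) (simp add: algebra_simps)
    then show "0 \<le> (F (u + t *\<^sub>R (v - u)) - F u) / t" using t by simp
  qed simp
  then show ?thesis
    using tendsto_lowerbound[OF has_gradient_on_directional[OF assms(1,2) u(1)[OF assms(4)] assms(4)]]
    by simp
qed

text \<open>Far from \<open>z\<close> the quadratic growth outweighs the linear term, so
  \<open>F\<close> exceeds \<open>F z\<close> there, and a minimiser over the compact part of
  \<open>X\<close> near \<open>z\<close> is global.\<close>

lemma quadratic_growth_ex_arg_min:
  fixes \<pi> :: "'a::euclidean_space \<Rightarrow> real"
  assumes n: "is_norm nrm" and cl: "closed X" and ne: "z \<in> X"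
    and grad: "has_gradient_on F F' X" and s: "s > 0"
    and growth: "\<And>v. v \<in> X \<Longrightarrow> s * (nrm (z - v))\<^sup>2 \<le> F v - F z - F' z \<bullet> (v - z)"
  shows "\<exists>u. is_arg_min F (\<lambda>x. x \<in> X) u"
proof -
  obtain \<kappa> where \<kappa>: "\<kappa> > 0" "\<And>x. \<kappa> * norm x \<le> nrm x"
    using is_norm_bounded_below[OF n] by blast
  \<comment> \<open>\<open>R\<close> is the radius at which
    \<open>s * \<kappa>\<^sup>2 * r\<^sup>2\<close> overtakes
    \<open>norm (F' z) * r\<close>.\<close>
  define R where "R = norm (F' z) / (s * \<kappa>\<^sup>2)"
  have R: "R \<ge> 0" using s \<kappa> by (simp add: R_def)
  have far: "F z < F v" if v: "v \<in> X" "R < norm (v - z)" for v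
  proof -
    have "F' z \<bullet> (v - z) \<ge> - (norm (F' z) * norm (v - z))"
      using Cauchy_Schwarz_ineq2[of "F' z" "v - z"] by (simp add: abs_le_iff)
    moreover have "s * (\<kappa> * norm (v - z))\<^sup>2 \<le> s * (nrm (z - v))\<^sup>2"
      using s \<kappa>(1) \<kappa>(2)[of "z - v"] by (intro mult_left_mono power_mono) (auto simp: norm_minus_commute)
    moreover have "norm (F' z) * norm (v - z) < s * \<kappa>\<^sup>2 * norm (v - z) * norm (v - z)"
    proof (rule mult_strict_right_mono)
      show "norm (F' z) < s * \<kappa>\<^sup>2 * norm (v - z)"
        using v(2) s \<kappa> by (simp add: R_def field_simps)
      show "0 < norm (v - z)" using v R by linarith
    qed
    ultimately show ?thesis using growth[OF v(1)] by (simp add: power2_eq_square algebra_simps)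
  qed
  have "continuous_on X F"
    using grad has_derivative_continuous
    unfolding has_gradient_on_def continuous_on_eq_continuous_within by blast
  then have "continuous_on (X \<inter> cball z R) F" by (rule continuous_on_subset) auto
  moreover have "compact (X \<inter> cball z R)" using cl by (simp add: closed_Int_compact)
  moreover have z: "z \<in> X \<inter> cball z R" using ne R by simp
  ultimately obtain u where u: "u \<in> X" "\<And>y. y \<in> X \<inter> cball z R \<Longrightarrow> F u \<le> F y"
    using continuous_attains_inf[of "X \<inter> cball z R" F] by blast
  have "F u \<le> F y" if "y \<in> X" for y
  proof (cases "norm (y - z) \<le> R")
    case True
    with that u(2) show ?thesis by (simp add: dist_norm norm_minus_commute)
  next
    case False
    with far[OF that] u(2)[OF z] show ?thesis by linarith
  qed
  with u(1) show ?thesis by (auto simp: is_arg_min_linorder)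
qed

text \<open>On \<open>X\<close> the objective is, up to affine terms, \<open>b + c\<close> times the
  function generating \<open>V\<close>, so its Bregman distance is \<open>V\<close> scaled by
  \<open>b + c\<close>. Together with the optimality condition this gives the three-point
  inequality. Existence of a minimiser comes first, since \<open>arg_min_on\<close> is only a choice
  operator.\<close>

lemma prox_arg_min:
  fixes G :: "'a::euclidean_space"
  assumes X: "closed X" "convex X" and n: "is_norm nrm" and V: "prox_function X nrm \<nu> V"
    and xu: "x \<in> X" "u \<in> X" and bc: "b + c > 0"
    and aff: "\<And>v w. l v - l w = G \<bullet> (v - w)"
    and u': "u' = arg_min_on (\<lambda>v. l v + b * V x v + c * V u v) X"
  shows "u' \<in> X" and "v \<in> X \<Longrightarrow>
      l u' + b * V x u' + c * V u u' + (b + c) * V u' v \<le> l v + b * V x v + c * V u v"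
proof -
  obtain \<pi> \<pi>' where \<nu>: "\<nu> > 0" and grad: "has_gradient_on \<pi> \<pi>' X"
    and sc: "strongly_convex_on X nrm \<nu> \<pi>"
    and VX: "\<And>x u. x \<in> X \<Longrightarrow> u \<in> X \<Longrightarrow> V x u = \<pi> u - \<pi> x - \<pi>' x \<bullet> (u - x)"
    using V unfolding prox_function_def by blast
  let ?F = "\<lambda>v. l v + b * V x v + c * V u v"
  let ?F' = "\<lambda>w. G + b *\<^sub>R (\<pi>' w - \<pi>' x) + c *\<^sub>R (\<pi>' w - \<pi>' u)"
  have diff: "?F v - ?F w - ?F' w \<bullet> (v - w) = (b + c) * V w v" if "v \<in> X" "w \<in> X" for v w
    using aff[of v w] that xu
    by (simp add: VX algebra_simps inner_diff_left inner_diff_right inner_add_left)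
  have gF: "has_gradient_on ?F ?F' X"
    unfolding has_gradient_on_def
  proof
    fix w assume w: "w \<in> X"
    \<comment> \<open>\<open>V\<close> has its Bregman form only on \<open>X\<close>, and
      \<open>l\<close> is known only through differences, so an explicit formula is differentiated
      and the result transferred to the objective, which agrees with it on \<open>X\<close>.\<close>
    have "((\<lambda>v. (l w + G \<bullet> (v - w)) + b * (\<pi> v - \<pi> x - \<pi>' x \<bullet> (v - x))
         + c * (\<pi> v - \<pi> u - \<pi>' u \<bullet> (v - u)))
        has_derivative (\<lambda>d. ?F' w \<bullet> d)) (at w within X)"
      using grad w unfolding has_gradient_on_def
      by (auto intro!: derivative_eq_intros simp: inner_add_left inner_diff_left algebra_simps)
    then show "(?F has_derivative (\<lambda>d. ?F' w \<bullet> d)) (at w within X)"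
    proof (rule has_derivative_transform[OF w, rotated])
      fix v assume v: "v \<in> X"
      have "l v = l w + G \<bullet> (v - w)" using aff[of v w] by simp
      then show "?F v = (l w + G \<bullet> (v - w)) + b * (\<pi> v - \<pi> x - \<pi>' x \<bullet> (v - x))
         + c * (\<pi> v - \<pi> u - \<pi>' u \<bullet> (v - u))"
        using v xu by (simp add: VX)
    qed
  qed
  have "(b + c) * \<nu> / 2 * (nrm (x - v))\<^sup>2 \<le> ?F v - ?F x - ?F' x \<bullet> (v - x)" if "v \<in> X" for v
    using mult_left_mono[OF prox_function_ge[OF V xu(1) that], of "b + c"] bc
    by (subst diff[OF that xu(1)]) (simp add: mult.assoc)
  from quadratic_growth_ex_arg_min[OF n X(1) xu(1) gF _ this] bc \<nu>
  have "\<exists>u. is_arg_min ?F (\<lambda>x. x \<in> X) u" by auto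
  then have min: "is_arg_min ?F (\<lambda>x. x \<in> X) u'"
    unfolding u' arg_min_on_def arg_min_def by (rule someI_ex)
  then show u'X: "u' \<in> X" by (simp add: is_arg_min_def)
  show "l u' + b * V x u' + c * V u u' + (b + c) * V u' v \<le> ?F v" if "v \<in> X"
    using has_gradient_on_arg_min[OF gF X(2) min that] diff[OF that u'X] by simp
qed


section \<open>The inner iterations\<close>

lemma lin_approx_convex_comb:
  "lin_approx f f' u ((1 - a) *\<^sub>R x + a *\<^sub>R y)
    = (1 - a) * lin_approx f f' u x + a * lin_approx f f' u y"
  by (simp add: lin_approx_def algebra_simps inner_add_right inner_diff_right)

lemma convex_comb_mem:
  "convex X \<Longrightarrow> x \<in> X \<Longrightarrow> y \<in> X \<Longrightarrow> 0 \<le> a \<Longrightarrow> a \<le> 1 \<Longrightarrow> (1 - a) *\<^sub>R x + a *\<^sub>R y \<in> X"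
  for a :: real
  by (rule convexD) auto

locale composite_problem =
  fixes X :: "'a::euclidean_space set" and nrm :: "'a \<Rightarrow> real"
    and f h :: "'a \<Rightarrow> real" and f' h' :: "'a \<Rightarrow> 'a"
    and V :: "'a \<Rightarrow> 'a \<Rightarrow> real" and L M \<nu> :: real
  assumes X: "closed X" "convex X"
    and nrm: "is_norm nrm"
    and LM_pos: "L > 0" "M > 0"
    and f_smooth: "\<And>x u. x \<in> X \<Longrightarrow> u \<in> X \<Longrightarrow>
          0 \<le> f x - lin_approx f f' u x \<and>
          f x - lin_approx f f' u x \<le> L / 2 * (nrm (x - u))\<^sup>2"
    and h_smooth: "\<And>x u. x \<in> X \<Longrightarrow> u \<in> X \<Longrightarrow>
          0 \<le> h x - lin_approx h h' u x \<and>
          h x - lin_approx h h' u x \<le> M / 2 * (nrm (x - u))\<^sup>2"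
    and V: "prox_function X nrm \<nu> V"
begin

lemma nu_pos: "\<nu> > 0"
  using V by (simp add: prox_function_def)

lemma nrm_scale: "nrm (c *\<^sub>R x) = \<bar>c\<bar> * nrm x"
  using nrm by (auto simp: is_norm_def)

lemma V_nonneg: "x \<in> X \<Longrightarrow> u \<in> X \<Longrightarrow> 0 \<le> V x u"
  using prox_function_ge[OF V, of x u] nu_pos
  by (meson divide_nonneg_nonneg less_imp_le mult_nonneg_nonneg order_trans zero_le_numeral zero_le_power2)

text \<open>The smoothness error of \<open>h\<close> between \<open>ul\<close> and \<open>w'\<close>
  is quadratic in \<open>lam * a\<close>. By \<open>M * lam * a \<le> \<nu> * c\<close> it is at
  most \<open>lam * a * (c * V u u')\<close>, a term that the three-point inequality supplies. The
  model \<open>g\<close> is affine and splits exactly.\<close>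

lemma prox_step:
  fixes y xb ut x u u' v ul :: 'a and lam a \<beta> c :: real
  defines "g \<equiv> lin_approx f f' y"
    and "w \<equiv> (1 - lam) *\<^sub>R xb + lam *\<^sub>R ut"
    and "w' \<equiv> (1 - lam) *\<^sub>R xb + lam *\<^sub>R ((1 - a) *\<^sub>R ut + a *\<^sub>R u')"
  assumes mem: "xb \<in> X" "ut \<in> X" "x \<in> X" "u \<in> X" "v \<in> X"
    and lam: "0 \<le> lam" "lam \<le> 1" and a: "0 \<le> a" "a \<le> 1"
    and \<beta>c: "\<beta> > 0" "c \<ge> 0" "M * lam * a \<le> \<nu> * c"
    and ul: "ul = (1 - lam) *\<^sub>R xb + (lam * (1 - a)) *\<^sub>R ut + (lam * a) *\<^sub>R u"
    and u': "u' = arg_min_on (\<lambda>v. g v + lin_approx h h' ul v + \<beta> * V x v + c * V u v) X"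
  shows "u' \<in> X"
    and "g w' + h w' \<le> (1 - a) * (g w + h w) + a * (1 - lam) * (g xb + h xb)
      + a * lam * (g v + h v + \<beta> * (V x v - V x u' - V u' v) + c * (V u v - V u' v))"
proof -
  note comb = convex_comb_mem[OF X(2)]
  let ?l = "lin_approx h h' ul"
  have aff: "(g v + ?l v) - (g w + ?l w) = (f' y + h' ul) \<bullet> (v - w)" for v w
    by (simp add: g_def lin_approx_def inner_add_left inner_diff_right)
  have bc: "\<beta> + c > 0" using \<beta>c by simp
  note am = prox_arg_min[OF X nrm V mem(3,4) bc aff u']
  show u'X: "u' \<in> X" by (rule am(1))
  have ulX: "ul \<in> X"
  proof -
    have "ul = (1 - lam) *\<^sub>R xb + lam *\<^sub>R ((1 - a) *\<^sub>R ut + a *\<^sub>R u)"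
      by (simp add: ul algebra_simps)
    then show ?thesis using mem lam a comb by simp
  qed
  have wX: "w \<in> X" using mem lam comb by (simp add: w_def)
  have w'X: "w' \<in> X" unfolding w'_def using mem lam a u'X comb by simp
  \<comment> \<open>This form lets affine models at \<open>w'\<close> split over \<open>w\<close>,
    \<open>xb\<close> and \<open>u'\<close>.\<close>
  have w'_split: "w' = (1 - a) *\<^sub>R w + a *\<^sub>R ((1 - lam) *\<^sub>R xb + lam *\<^sub>R u')"
    by (simp add: w_def w'_def algebra_simps)
  \<comment> \<open>\<open>ul\<close> uses the old \<open>u\<close> exactly where \<open>w'\<close>
    uses the new \<open>u'\<close>, so everything else cancels.\<close>
  have w'_ul: "w' - ul = (lam * a) *\<^sub>R (u' - u)"
    by (simp add: w'_def ul algebra_simps)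
  have "h w' \<le> ?l w' + M / 2 * (nrm (w' - ul))\<^sup>2"
    using h_smooth[OF w'X ulX] by simp
  also have "M / 2 * (nrm (w' - ul))\<^sup>2 = (lam * a) * ((M * lam * a) / 2 * (nrm (u - u'))\<^sup>2)"
    unfolding w'_ul nrm_scale using is_norm_minus[OF nrm, of "u - u'"]
    by (simp add: power2_eq_square algebra_simps)
  also have "\<dots> \<le> (lam * a) * (c * V u u')"
  proof (rule mult_left_mono)
    have "(M * lam * a) / 2 * (nrm (u - u'))\<^sup>2 \<le> (\<nu> * c) / 2 * (nrm (u - u'))\<^sup>2"
      using \<beta>c by (intro mult_right_mono divide_right_mono) auto
    also have "\<dots> = c * (\<nu> / 2 * (nrm (u - u'))\<^sup>2)" by simp
    also have "\<dots> \<le> c * V u u'"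
      using \<beta>c prox_function_ge[OF V mem(4) u'X] by (intro mult_left_mono) auto
    finally show "(M * lam * a) / 2 * (nrm (u - u'))\<^sup>2 \<le> c * V u u'" .
  qed (use lam a in simp)
  also have "?l w' = (1 - a) * ?l w + a * (1 - lam) * ?l xb + a * lam * ?l u'"
    unfolding w'_split lin_approx_convex_comb by (simp add: algebra_simps)
  finally have "h w' \<le> (1 - a) * ?l w + a * (1 - lam) * ?l xb + a * lam * ?l u' + lam * a * (c * V u u')"
    by simp
  moreover have "(1 - a) * ?l w \<le> (1 - a) * h w"
    using a h_smooth[OF wX ulX] by (intro mult_left_mono) auto
  moreover have "a * (1 - lam) * ?l xb \<le> a * (1 - lam) * h xb"
    using a lam h_smooth[OF mem(1) ulX] by (intro mult_left_mono) auto
  moreover have "g w' = (1 - a) * g w + a * (1 - lam) * g xb + a * lam * g u'"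
    unfolding w'_split g_def lin_approx_convex_comb by (simp add: algebra_simps)
  moreover have "a * lam * (g u' + ?l u' + \<beta> * V x u' + c * V u u' + (\<beta> + c) * V u' v)
      \<le> a * lam * (g v + h v + \<beta> * V x v + c * V u v)"
    using am(2)[OF mem(5)] h_smooth[OF mem(5) ulX] a lam by (intro mult_left_mono) auto
  ultimately show "g w' + h w' \<le> (1 - a) * (g w + h w) + a * (1 - lam) * (g xb + h xb)
      + a * lam * (g v + h v + \<beta> * (V x v - V x u' - V u' v) + c * (V u v - V u' v))"
    by (simp add: algebra_simps)
qed

end

text \<open>\<open>W\<alpha>\<close> and \<open>Wp\<close> make the coefficients of
  \<open>V (u t) v\<close> telescope: the prox centre contributes
  \<open>\<beta> * (W (Suc t) - W t)\<close> and \<open>p\<close> contributes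
  \<open>\<beta> * W t\<close>, while by \<open>Wq\<close> the share of \<open>q\<close> is a
  constant \<open>Q\<close>. Allowing any \<open>W 0 \<ge> 0\<close> covers both parameter choices,
  with \<open>W 0 = 0\<close> in the first call and \<open>W 0 = 2\<close> later.\<close>

locale prox_ag_run = composite_problem X nrm f h f' h' V L M \<nu>
  for X :: "'a::euclidean_space set" and nrm f h f' h' V L M \<nu> +
  fixes \<alpha> p q W :: "nat \<Rightarrow> real" and Q lam \<beta> :: real
    and y xb x :: 'a and u ut :: "nat \<Rightarrow> 'a" and n :: "nat \<Rightarrow> nat"
  assumes mem: "y \<in> X" "xb \<in> X" "x \<in> X"
    and lam: "0 \<le> lam" "lam \<le> 1" and \<beta>: "\<beta> > 0"
    and \<alpha>: "\<And>t. 0 < \<alpha> (Suc t)" "\<And>t. \<alpha> (Suc t) \<le> 1"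
    and W: "0 \<le> W 0" "\<And>t. 0 < W (Suc t)"
    and W\<alpha>: "\<And>t. W (Suc t) * \<alpha> (Suc t) = W (Suc t) - W t"
    and Wp: "\<And>t. W (Suc t) * \<alpha> (Suc t) * p (Suc t) = W t"
    and Wq: "\<And>t. W (Suc t) * \<alpha> (Suc t) * q (Suc t) = Q"
    and q: "\<And>t. M * lam * \<alpha> (Suc t) \<le> \<nu> * q (Suc t)"
    and run: "\<And>t. prox_ag X h h' V \<alpha> p q (lin_approx f f' y) xb x lam \<beta> t = (u t, ut t, n t)"
begin

abbreviation "g \<equiv> lin_approx f f' y"

text \<open>The averaged outer iterate that would result from stopping after \<open>t\<close> inner
  steps; the objective is tracked at these points.\<close>

definition w :: "nat \<Rightarrow> 'a" where "w t = (1 - lam) *\<^sub>R xb + lam *\<^sub>R ut t"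

lemma run_0: "u 0 = x" "ut 0 = xb" "n 0 = 0"
  using run[of 0] by auto

lemma run_Suc:
  "u (Suc t) = arg_min_on (\<lambda>v. g v + lin_approx h h'
      ((1 - lam) *\<^sub>R xb + (lam * (1 - \<alpha> (Suc t))) *\<^sub>R ut t + (lam * \<alpha> (Suc t)) *\<^sub>R u t) v
      + \<beta> * V x v + (\<beta> * p (Suc t) + q (Suc t)) * V (u t) v) X"
  "ut (Suc t) = (1 - \<alpha> (Suc t)) *\<^sub>R ut t + \<alpha> (Suc t) *\<^sub>R u (Suc t)"
  "n (Suc t) = Suc (n t)"
  using run[of "Suc t"] by (auto simp: run[of t] Let_def)

lemma n_eq: "n t = t"
  by (induction t) (simp_all add: run_0 run_Suc)

lemma W_nonneg: "0 \<le> W t"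
  using W by (cases t) (auto intro: less_imp_le)

text \<open>These are the conditions that \<open>prox_step\<close> puts on its \<open>c\<close>. The
  sign of \<open>p\<close> is read off \<open>Wp\<close>, that of \<open>q\<close> off the bound on
  \<open>q\<close>.\<close>

lemma coeff_nonneg: "0 \<le> \<beta> * p (Suc t) + q (Suc t)" "M * lam * \<alpha> (Suc t) \<le> \<nu> * (\<beta> * p (Suc t) + q (Suc t))"
proof -
  have pos: "0 < W (Suc t) * \<alpha> (Suc t)" using W(2) \<alpha>(1) by simp
  have "0 \<le> W (Suc t) * \<alpha> (Suc t) * p (Suc t)" using Wp W_nonneg by simp
  then have p: "0 \<le> p (Suc t)" using pos by (simp add: zero_le_mult_iff)
  have "0 \<le> M * lam * \<alpha> (Suc t)" using LM_pos lam \<alpha>(1)[of t] by simp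
  then have "0 \<le> \<nu> * q (Suc t)" using q[of t] by linarith
  then have q0: "0 \<le> q (Suc t)" using nu_pos by (simp add: zero_le_mult_iff)
  show "0 \<le> \<beta> * p (Suc t) + q (Suc t)" using p q0 \<beta> by simp
  have "0 \<le> \<nu> * (\<beta> * p (Suc t))" using p \<beta> nu_pos by simp
  then show "M * lam * \<alpha> (Suc t) \<le> \<nu> * (\<beta> * p (Suc t) + q (Suc t))"
    using q[of t] by (simp add: distrib_left)
qed

lemma iterates_mem: "u t \<in> X" "ut t \<in> X"
proof (induction t)
  case 0
  { case 1 show ?case by (simp add: run_0 mem) next case 2 show ?case by (simp add: run_0 mem) }
next
  case (Suc t)
  \<comment> \<open>The comparison point \<open>v\<close> of \<open>prox_step\<close> is
    instantiated by \<open>x\<close>, through the second \<open>mem(3)\<close>.\<close>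
  have uX: "u (Suc t) \<in> X"
    by (rule prox_step(1)[OF mem(2) Suc(2) mem(3) Suc(1) mem(3) lam less_imp_le[OF \<alpha>(1)] \<alpha>(2) \<beta>
          coeff_nonneg refl run_Suc(1)])
  { case 1 show ?case by (rule uX) next
    case 2 show ?case unfolding run_Suc(2)
      by (rule convex_comb_mem[OF X(2) Suc(2) uX less_imp_le[OF \<alpha>(1)] \<alpha>(2)]) }
qed

lemma w_mem: "w t \<in> X"
  unfolding w_def by (rule convex_comb_mem[OF X(2) mem(2) iterates_mem(2) lam])

text \<open>The \<open>W\<close>-weighted sum of the step inequalities. The terms
  \<open>V x (u (Suc s))\<close> are kept on the left because they later pay for replacing
  \<open>f\<close> by \<open>g\<close>.\<close>

lemma model_bound:
  assumes v: "v \<in> X"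
  shows "W t * (g (w t) + h (w t)) + lam * (\<beta> * W t + Q) * V (u t) v
      + lam * \<beta> * (\<Sum>s<t. (W (Suc s) - W s) * V x (u (Suc s)))
    \<le> W 0 * (g xb + h xb) + (W t - W 0) * ((1 - lam) * (g xb + h xb) + lam * (g v + h v))
      + lam * (\<beta> * W t + Q) * V x v"
proof (induction t)
  case 0
  have "w 0 = xb" by (simp add: w_def run_0 algebra_simps)
  then show ?case by (simp add: run_0)
next
  case (Suc t)
  let ?\<Psi> = "\<lambda>z. g z + h z" and ?a = "\<alpha> (Suc t)" and ?W = "W (Suc t)"
  let ?c = "\<beta> * p (Suc t) + q (Suc t)"
  have "?\<Psi> (w (Suc t)) \<le> (1 - ?a) * ?\<Psi> (w t) + ?a * (1 - lam) * ?\<Psi> xb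
      + ?a * lam * (?\<Psi> v + \<beta> * (V x v - V x (u (Suc t)) - V (u (Suc t)) v)
        + ?c * (V (u t) v - V (u (Suc t)) v))"
    unfolding w_def run_Suc(2)
    by (rule prox_step(2)[OF mem(2) iterates_mem(2) mem(3) iterates_mem(1) v lam less_imp_le[OF \<alpha>(1)] \<alpha>(2) \<beta>
          coeff_nonneg refl run_Suc(1)])
  then have "?W * ?\<Psi> (w (Suc t)) \<le> ?W * ((1 - ?a) * ?\<Psi> (w t) + ?a * (1 - lam) * ?\<Psi> xb
      + ?a * lam * (?\<Psi> v + \<beta> * (V x v - V x (u (Suc t)) - V (u (Suc t)) v)
        + ?c * (V (u t) v - V (u (Suc t)) v)))"
    using W(2)[of t] by (intro mult_left_mono) auto
  also have "\<dots> = (?W - ?W * ?a) * ?\<Psi> (w t) + (?W * ?a) * (1 - lam) * ?\<Psi> xb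
      + (?W * ?a) * lam * (?\<Psi> v + \<beta> * (V x v - V x (u (Suc t)) - V (u (Suc t)) v))
      + lam * (\<beta> * (?W * ?a * p (Suc t)) + ?W * ?a * q (Suc t)) * (V (u t) v - V (u (Suc t)) v)"
    by (simp add: algebra_simps)
  finally have "?W * ?\<Psi> (w (Suc t)) \<le> W t * ?\<Psi> (w t) + (?W - W t) * (1 - lam) * ?\<Psi> xb
      + (?W - W t) * lam * (?\<Psi> v + \<beta> * (V x v - V x (u (Suc t)) - V (u (Suc t)) v))
      + lam * (\<beta> * W t + Q) * (V (u t) v - V (u (Suc t)) v)"
    \<comment> \<open>\<open>Wp\<close> and \<open>Wq\<close> come before \<open>W\<alpha>\<close>,
      whose left side occurs inside theirs.\<close>
    unfolding Wp Wq unfolding W\<alpha> by simp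
  with Suc show ?case by (simp add: algebra_simps)
qed

lemma w_average:
  "W t *\<^sub>R w t = (W 0 + (W t - W 0) * (1 - lam)) *\<^sub>R xb + lam *\<^sub>R (\<Sum>s<t. (W (Suc s) - W s) *\<^sub>R u (Suc s))"
proof (induction t)
  case 0
  have "w 0 = xb" by (simp add: w_def run_0 algebra_simps)
  then show ?case by simp
next
  case (Suc t)
  let ?a = "\<alpha> (Suc t)" and ?W = "W (Suc t)"
  have "?W *\<^sub>R w (Suc t) = (?W - ?W * ?a) *\<^sub>R w t + (?W * ?a) *\<^sub>R ((1 - lam) *\<^sub>R xb + lam *\<^sub>R u (Suc t))"
    by (simp add: w_def run_Suc(2) algebra_simps)
  also have "\<dots> = W t *\<^sub>R w t + (?W - W t) *\<^sub>R ((1 - lam) *\<^sub>R xb + lam *\<^sub>R u (Suc t))"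
    by (simp only: W\<alpha>) simp
  finally show ?case using Suc by (simp add: algebra_simps)
qed

text \<open>The condition on \<open>\<gamma>\<close> makes the multiples of \<open>xb\<close>
  cancel, so that \<open>W t\<close> times \<open>w t - y\<close> is \<open>lam\<close> times a
  weighted sum of the \<open>u (Suc s) - x\<close>. The triangle inequality and Cauchy-Schwarz bound
  its square.\<close>

lemma nrm_sq_average:
  assumes \<gamma>: "W t * \<gamma> = lam * (W t - W 0)" and t: "t \<ge> 1" and y: "y = (1 - \<gamma>) *\<^sub>R xb + \<gamma> *\<^sub>R x"
  shows "W t * (nrm (w t - y))\<^sup>2 \<le> \<gamma> * lam * (\<Sum>s<t. (W (Suc s) - W s) * (nrm (x - u (Suc s)))\<^sup>2)"
proof -
  let ?d = "\<lambda>s. W (Suc s) - W s"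
  have d: "0 \<le> ?d s" for s
    using W\<alpha>[of s] W(2)[of s] \<alpha>(1)[of s] by (metis less_imp_le mult_pos_pos)
  have sumd: "(\<Sum>s<t. ?d s) = W t - W 0" by (rule sum_lessThan_telescope)
  have Wt: "W t > 0" using W(2)[of "t - 1"] t by simp
  have "W t *\<^sub>R (w t - y) = W t *\<^sub>R w t - (W t - W t * \<gamma>) *\<^sub>R xb - (W t * \<gamma>) *\<^sub>R x"
    by (simp add: y algebra_simps)
  also have "\<dots> = lam *\<^sub>R (\<Sum>s<t. ?d s *\<^sub>R u (Suc s)) - lam *\<^sub>R ((\<Sum>s<t. ?d s) *\<^sub>R x)"
    unfolding w_average \<gamma> sumd by (simp add: algebra_simps)
  also have "\<dots> = lam *\<^sub>R (\<Sum>s<t. ?d s *\<^sub>R (u (Suc s) - x))"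
    unfolding scaleR_right_diff_distrib sum_subtractf scaleR_sum_left[symmetric] by simp
  finally have "W t * nrm (w t - y) = lam * nrm (\<Sum>s<t. ?d s *\<^sub>R (u (Suc s) - x))"
    using nrm_scale[of "W t" "w t - y"] Wt lam by (simp add: nrm_scale)
  also have "\<dots> \<le> lam * (\<Sum>s<t. nrm (?d s *\<^sub>R (u (Suc s) - x)))"
    using lam by (intro mult_left_mono is_norm_sum_le[OF nrm]) auto
  \<comment> \<open>Splitting each weight into two square roots lets Cauchy-Schwarz produce the
    factor \<open>W t - W 0\<close>, and \<open>lam * (W t - W 0)\<close> is
    \<open>W t * \<gamma>\<close>.\<close>
  also have "\<dots> = lam * (\<Sum>s<t. sqrt (?d s) * (sqrt (?d s) * nrm (x - u (Suc s))))"
    using d is_norm_minus[OF nrm, of "x - u (Suc _)"] by (simp add: nrm_scale mult.assoc[symmetric])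
  finally have "(W t * nrm (w t - y))\<^sup>2
      \<le> (lam * (\<Sum>s<t. sqrt (?d s) * (sqrt (?d s) * nrm (x - u (Suc s)))))\<^sup>2"
    using Wt is_norm_nonneg[OF nrm] by (intro power_mono) auto
  also have "\<dots> \<le> lam\<^sup>2 * ((\<Sum>s<t. (sqrt (?d s))\<^sup>2) * (\<Sum>s<t. (sqrt (?d s) * nrm (x - u (Suc s)))\<^sup>2))"
    unfolding power_mult_distrib[of lam] by (intro mult_left_mono Cauchy_Schwarz_ineq_sum) auto
  also have "\<dots> = W t * (\<gamma> * lam * (\<Sum>s<t. ?d s * (nrm (x - u (Suc s)))\<^sup>2))"
    using d sumd \<gamma> by (simp add: power_mult_distrib power2_eq_square mult_ac)
  finally have "W t * (W t * (nrm (w t - y))\<^sup>2)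
      \<le> W t * (\<gamma> * lam * (\<Sum>s<t. ?d s * (nrm (x - u (Suc s)))\<^sup>2))"
    by (simp add: power_mult_distrib power2_eq_square mult_ac)
  then show ?thesis using Wt by (simp add: mult_le_cancel_left_pos)
qed

text \<open>Because \<open>L * \<gamma> \<le> \<beta> * \<nu>\<close>, the error of \<open>g\<close>
  at \<open>w t\<close> is paid for by the terms \<open>V x (u (Suc s))\<close>; at
  \<open>xb\<close> and \<open>v\<close> the model lies below \<open>f\<close>. Division by
  \<open>W t\<close> finishes.\<close>

lemma composite_bound:
  assumes \<gamma>: "W t * \<gamma> = lam * (W t - W 0)" and t: "t \<ge> 1" and y: "y = (1 - \<gamma>) *\<^sub>R xb + \<gamma> *\<^sub>R x"
    and \<gamma>01: "0 \<le> \<gamma>" "\<gamma> \<le> 1" and \<beta>\<gamma>: "L * \<gamma> \<le> \<beta> * \<nu>" and v: "v \<in> X"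
  shows "f (w t) + h (w t) \<le> (1 - \<gamma>) * (f xb + h xb) + \<gamma> * (f v + h v)
    + lam * (\<beta> + Q / W t) * (V x v - V (u t) v)"
proof -
  let ?D = "\<Sum>s<t. (W (Suc s) - W s) * V x (u (Suc s))"
  let ?E = "\<Sum>s<t. (W (Suc s) - W s) * (nrm (x - u (Suc s)))\<^sup>2"
  define r where "r = \<beta> + Q / W t"
  have d: "0 \<le> W (Suc s) - W s" for s
    using W\<alpha>[of s] W(2)[of s] \<alpha>(1)[of s] by (metis less_imp_le mult_pos_pos)
  have Wt: "W t > 0" using W(2)[of "t - 1"] t by simp
  have E0: "0 \<le> ?E" by (intro sum_nonneg mult_nonneg_nonneg d) simp
  have "\<nu> / 2 * ?E \<le> ?D"
    unfolding sum_distrib_left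
  proof (rule sum_mono)
    fix s
    have "(W (Suc s) - W s) * (\<nu> / 2 * (nrm (x - u (Suc s)))\<^sup>2) \<le> (W (Suc s) - W s) * V x (u (Suc s))"
      by (intro mult_left_mono d prox_function_ge[OF V] mem iterates_mem)
    then show "\<nu> / 2 * ((W (Suc s) - W s) * (nrm (x - u (Suc s)))\<^sup>2) \<le> (W (Suc s) - W s) * V x (u (Suc s))"
      by (simp add: mult_ac)
  qed
  then have DE: "lam * \<beta> * (\<nu> / 2 * ?E) \<le> lam * \<beta> * ?D" using lam \<beta> by (intro mult_left_mono) auto
  have "W t * f (w t) \<le> W t * (g (w t) + L / 2 * (nrm (w t - y))\<^sup>2)"
    using f_smooth[OF w_mem mem(1), of t] Wt by (intro mult_left_mono) auto
  moreover have "L / 2 * (W t * (nrm (w t - y))\<^sup>2) \<le> L / 2 * (\<gamma> * lam * ?E)"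
    using LM_pos by (intro mult_left_mono nrm_sq_average[OF \<gamma> t y]) auto
  moreover have "(L * \<gamma>) * (lam / 2 * ?E) \<le> (\<beta> * \<nu>) * (lam / 2 * ?E)"
    using lam E0 by (intro mult_right_mono \<beta>\<gamma>) auto
  ultimately have fw: "W t * f (w t) \<le> W t * g (w t) + lam * \<beta> * ?D"
    using DE by (simp add: algebra_simps)
  have "W t * (f (w t) + h (w t)) + lam * (\<beta> * W t + Q) * V (u t) v
      \<le> (W t - lam * (W t - W 0)) * (g xb + h xb) + (lam * (W t - W 0)) * (g v + h v)
        + lam * (\<beta> * W t + Q) * V x v"
    using model_bound[OF v, of t] fw by (simp add: algebra_simps)
  also have "\<dots> = W t * ((1 - \<gamma>) * (g xb + h xb) + \<gamma> * (g v + h v)) + lam * (\<beta> * W t + Q) * V x v"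
    unfolding \<gamma>[symmetric] by (simp add: algebra_simps)
  finally have "W t * (f (w t) + h (w t)) \<le> W t * ((1 - \<gamma>) * (g xb + h xb) + \<gamma> * (g v + h v))
      + lam * (\<beta> * W t + Q) * (V x v - V (u t) v)"
    by (simp add: right_diff_distrib)
  also have "\<beta> * W t + Q = W t * r" using Wt by (simp add: r_def field_simps)
  finally have "W t * (f (w t) + h (w t)) \<le> W t * ((1 - \<gamma>) * (g xb + h xb) + \<gamma> * (g v + h v)
      + lam * r * (V x v - V (u t) v))"
    by (simp add: algebra_simps)
  then have "f (w t) + h (w t) \<le> (1 - \<gamma>) * (g xb + h xb) + \<gamma> * (g v + h v)
      + lam * r * (V x v - V (u t) v)"
    using Wt by (simp add: mult_le_cancel_left_pos)
  moreover have "(1 - \<gamma>) * (g xb + h xb) \<le> (1 - \<gamma>) * (f xb + h xb)"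
    using f_smooth[OF mem(2,1)] \<gamma>01 by (intro mult_left_mono) auto
  moreover have "\<gamma> * (g v + h v) \<le> \<gamma> * (f v + h v)"
    using f_smooth[OF v mem(1)] \<gamma>01 by (intro mult_left_mono) auto
  ultimately show ?thesis unfolding r_def[symmetric] by linarith
qed

end

text \<open>Interface to the outer loop: the sequences of the run are projections of the inner
  state, and the weights \<open>W\<close> are a certificate that each kind of call supplies.\<close>

lemma (in composite_problem) prox_ag_bound:
  fixes T :: nat
  assumes mem: "xb \<in> X" "x \<in> X" and y: "y = (1 - \<gamma>) *\<^sub>R xb + \<gamma> *\<^sub>R x"
    and \<gamma>01: "0 \<le> \<gamma>" "\<gamma> \<le> 1" and lam: "0 \<le> lam" "lam \<le> 1"
    and \<beta>: "\<beta> > 0" "L * \<gamma> \<le> \<beta> * \<nu>"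
    and \<alpha>: "\<And>t. 0 < \<alpha> (Suc t)" "\<And>t. \<alpha> (Suc t) \<le> 1"
    and W: "0 \<le> W 0" "\<And>t. 0 < W (Suc t)"
    and W\<alpha>: "\<And>t. W (Suc t) * \<alpha> (Suc t) = W (Suc t) - W t"
    and Wp: "\<And>t. W (Suc t) * \<alpha> (Suc t) * p (Suc t) = W t"
    and Wq: "\<And>t. W (Suc t) * \<alpha> (Suc t) * q (Suc t) = Q"
    and q: "\<And>t. M * lam * \<alpha> (Suc t) \<le> \<nu> * q (Suc t)"
    and T: "T \<ge> 1" and W\<gamma>: "W T * \<gamma> = lam * (W T - W 0)"
    and res: "prox_ag X h h' V \<alpha> p q (lin_approx f f' y) xb x lam \<beta> T = (x', xt, n)"
  defines "xb' \<equiv> (1 - lam) *\<^sub>R xb + lam *\<^sub>R xt"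
  shows "x' \<in> X" "xb' \<in> X" "n = T"
    and "v \<in> X \<Longrightarrow> f xb' + h xb' \<le> (1 - \<gamma>) * (f xb + h xb) + \<gamma> * (f v + h v)
      + lam * (\<beta> + Q / W T) * (V x v - V x' v)"
proof -
  define P where "P = prox_ag X h h' V \<alpha> p q (lin_approx f f' y) xb x lam \<beta>"
  have yX: "y \<in> X" unfolding y by (rule convex_comb_mem[OF X(2) mem \<gamma>01])
  interpret run: prox_ag_run X nrm f h f' h' V L M \<nu> \<alpha> p q W Q lam \<beta> y xb x
      "\<lambda>t. fst (P t)" "\<lambda>t. fst (snd (P t))" "\<lambda>t. snd (snd (P t))"
    by unfold_locales (use yX mem lam \<beta> \<alpha> W W\<alpha> Wp Wq q in \<open>auto simp: P_def\<close>)
  have P: "P T = (x', xt, n)" using res by (simp add: P_def)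
  have w: "run.w T = xb'" by (simp add: run.w_def xb'_def P)
  show "x' \<in> X" using run.iterates_mem(1)[of T] P by simp
  show "xb' \<in> X" using run.w_mem[of T] w by simp
  show "n = T" using run.n_eq[of T] P by simp
  show "f xb' + h xb' \<le> (1 - \<gamma>) * (f xb + h xb) + \<gamma> * (f v + h v)
      + lam * (\<beta> + Q / W T) * (V x v - V x' v)" if "v \<in> X"
    using run.composite_bound[OF W\<gamma> T y \<gamma>01 \<beta>(2) that] w P by simp
qed

section \<open>Step sizes and the outer iteration\<close>

lemma step_size_bound:
  fixes T k :: nat
  assumes "T \<ge> 1"
  shows "2 / (real k + 1) * (real T + 1) * (real T + 2) / (real T * (real T + 3)) \<le> 3 / (real k + 1)"
proof -
  \<comment> \<open>The factor \<open>(T + 1) (T + 2) / (T (T + 3))\<close> equals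
    \<open>1 + 2 / (T (T + 3))\<close>, which is at most 3/2, with equality at
    \<open>T = 1\<close>.\<close>
  have "1 * 1 \<le> real T * real T" using assms by (intro mult_mono) auto
  then have "2 * ((real T + 1) * (real T + 2)) \<le> 3 * (real T * (real T + 3))"
    using assms by (simp add: algebra_simps)
  then have "2 * ((real T + 1) * (real T + 2)) / (real T * (real T + 3)) \<le> 3"
    using assms by (simp add: pos_divide_le_eq)
  then have "2 * ((real T + 1) * (real T + 2)) / (real T * (real T + 3)) / (real k + 1) \<le> 3 / (real k + 1)"
    by (intro divide_right_mono) auto
  then show ?thesis by (simp only: times_divide_eq_left times_divide_eq_right divide_divide_eq_left mult_ac)
qed

text \<open>\<open>Nf\<close> and \<open>Nh\<close> are real, whereas counts grow by whole outer
  iterations. Hence two readings: reaching either bound guarantees a solution, and a solution is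
  reached within the bounds up to rounding \<open>Nf\<close> to a full iteration.\<close>

theorem corollary1:
  fixes X :: "'a::euclidean_space set"
    and nrm :: "'a \<Rightarrow> real"
    and f h \<phi> :: "'a \<Rightarrow> real"
    and f' h' :: "'a \<Rightarrow> 'a"
    and V :: "'a \<Rightarrow> 'a \<Rightarrow> real"
    and L M \<nu> \<epsilon> Nf Nh :: real
    and \<gamma> lam \<beta> :: "nat \<Rightarrow> real"
    and T :: nat
    and Tk :: "nat \<Rightarrow> nat"
    and \<alpha> p q :: "nat \<Rightarrow> nat \<Rightarrow> real"
    and x0 xstar :: 'a
    and x xb :: "nat \<Rightarrow> 'a"
    and evals_f evals_h :: "nat \<Rightarrow> nat"
  assumes X: "closed X" "convex X"
    and nrm: "is_norm nrm"
    and f: "convex_on X f" "has_gradient_on f f' X" "continuous_on X f'"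
    and h: "convex_on X h" "has_gradient_on h h' X" "continuous_on X h'"
    and LM_pos: "L > 0" "M > 0"
    and f_smooth: "\<And>x u. x \<in> X \<Longrightarrow> u \<in> X \<Longrightarrow>
          0 \<le> f x - lin_approx f f' u x \<and>
          f x - lin_approx f f' u x \<le> L / 2 * (nrm (x - u))\<^sup>2"
    and h_smooth: "\<And>x u. x \<in> X \<Longrightarrow> u \<in> X \<Longrightarrow>
          0 \<le> h x - lin_approx h h' u x \<and>
          h x - lin_approx h h' u x \<le> M / 2 * (nrm (x - u))\<^sup>2"
    and M_ge_L: "M \<ge> L"
    and V: "prox_function X nrm \<nu> V"
    and \<phi>: "\<phi> = (\<lambda>x. f x + h x)"
    and xstar: "is_arg_min \<phi> (\<lambda>x. x \<in> X) xstar"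
    and x0: "x0 \<in> X"
    and \<epsilon>: "\<epsilon> > 0"
    and \<gamma>: "\<And>k. k \<ge> 1 \<Longrightarrow> \<gamma> k = 2 / (real k + 1)"
    and T: "T = nat \<lceil>sqrt (M / L)\<rceil>" "\<And>k. k \<ge> 1 \<Longrightarrow> Tk k = T"
    and lam: "lam 1 = 1"
          "\<And>k. k > 1 \<Longrightarrow>
             lam k = \<gamma> k * (real T + 1) * (real T + 2) / (real T * (real T + 3))"
    and \<beta>: "\<And>k. k \<ge> 1 \<Longrightarrow> \<beta> k = 3 * L * \<gamma> k / (\<nu> * real k * lam k)"
    and first_call: "\<And>t. t \<ge> 1 \<Longrightarrow> \<alpha> 1 t = 2 / (real t + 1)"
          "\<And>t. t \<ge> 1 \<Longrightarrow> p 1 t = (real t - 1) / 2"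
          "\<And>t. t \<ge> 1 \<Longrightarrow> q 1 t = 6 * M / (\<nu> * real t)"
    and later_calls: "\<And>k t. k > 1 \<Longrightarrow> t \<ge> 1 \<Longrightarrow> \<alpha> k t = 2 / (real t + 2)"
          "\<And>k t. k > 1 \<Longrightarrow> t \<ge> 1 \<Longrightarrow> p k t = real t / 2"
          "\<And>k t. k > 1 \<Longrightarrow> t \<ge> 1 \<Longrightarrow> q k t = 6 * M / (\<nu> * real k * (real t + 1))"
    and run: "\<And>N. ags X f f' h h' V \<gamma> lam \<beta> Tk \<alpha> p q x0 N =
                     (x N, xb N, evals_f N, evals_h N)"
    and Nf: "Nf = sqrt (30 * L * V x0 xstar / (\<nu> * \<epsilon>))"
    and Nh: "Nh = sqrt (30 * M * V x0 xstar / (\<nu> * \<epsilon>))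
                  + sqrt (30 * L * V x0 xstar / (\<nu> * \<epsilon>))"
  shows "(\<forall>N. real (evals_f N) \<ge> Nf \<or> real (evals_h N) \<ge> Nh
              \<longrightarrow> eps_solution X \<phi> \<epsilon> (xb N)) \<and>
         (\<exists>N. eps_solution X \<phi> \<epsilon> (xb N) \<and>
              real (evals_f N) \<le> of_int \<lceil>Nf\<rceil> \<and>
              real (evals_h N) \<le> Nh + (of_int \<lceil>Nf\<rceil> - Nf) * real T)"
proof -
  interpret composite_problem X nrm f h f' h' V L M \<nu>
    by unfold_locales (use X nrm LM_pos f_smooth h_smooth V in auto)
  note \<nu> = nu_pos

  \<comment> \<open>The size of \<open>T\<close> and the optimal value\<close>
  have root: "1 \<le> sqrt (M / L)" using M_ge_L LM_pos by simp
  have T_le: "sqrt (M / L) \<le> real T" "real T \<le> sqrt (M / L) + 1"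
    using root unfolding T(1) by linarith+
  have T1: "T \<ge> 1" using T_le root by linarith
  have "(sqrt (M / L))\<^sup>2 \<le> (real T)\<^sup>2" using T_le root by (intro power_mono) auto
  then have MT: "M \<le> L * (real T)\<^sup>2" using LM_pos by (simp add: field_simps)
  have xs: "xstar \<in> X" "\<And>z. z \<in> X \<Longrightarrow> \<phi> xstar \<le> \<phi> z"
    using xstar by (auto simp: is_arg_min_linorder)
  have inf: "(INF z\<in>X. \<phi> z) = \<phi> xstar"
    by (rule cInf_eq_minimum) (use xs in auto)

  \<comment> \<open>\<open>2 * C\<close> is the common value of \<open>k (k + 1) lam\<^sub>k
    (\<beta>\<^sub>k + Q\<^sub>k / W\<^sub>T)\<close> for \<open>k > 1\<close>; \<open>E\<close> is
    \<open>lam\<^sub>1 (\<beta>\<^sub>1 + Q\<^sub>1 / W\<^sub>T)\<close>, with the weights of the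
    first call.\<close>
  define C where "C = (3 * L + 12 * M / (real T * (real T + 3))) / \<nu>"
  define E where "E = (3 * L + 12 * M / (real T * (real T + 1))) / \<nu>"
  let ?V = "\<lambda>z. V z xstar"

  have init: "x 0 = x0" "xb 0 = x0" "evals_f 0 = 0" "evals_h 0 = 0"
    using run[of 0] by auto
  have step: "evals_f (Suc j) = evals_f j + 1"
      "\<exists>xt n. prox_ag X h h' V (\<alpha> (Suc j)) (p (Suc j)) (q (Suc j))
          (lin_approx f f' ((1 - \<gamma> (Suc j)) *\<^sub>R xb j + \<gamma> (Suc j) *\<^sub>R x j)) (xb j) (x j)
          (lam (Suc j)) (\<beta> (Suc j)) T = (x (Suc j), xt, n)
        \<and> xb (Suc j) = (1 - lam (Suc j)) *\<^sub>R xb j + lam (Suc j) *\<^sub>R xt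
        \<and> evals_h (Suc j) = evals_h j + n" for j
    using run[of "Suc j"] by (auto simp: run[of j] Let_def T(2) split: prod.splits)

  \<comment> \<open>The first call\<close>
  have first: "x 1 \<in> X" "xb 1 \<in> X" "evals_h 1 = T"
    "\<phi> (xb 1) \<le> \<phi> xstar + E * (?V (x 0) - ?V (x 1))"
  proof -
    obtain xt n where res: "prox_ag X h h' V (\<alpha> 1) (p 1) (q 1)
          (lin_approx f f' ((1 - \<gamma> 1) *\<^sub>R xb 0 + \<gamma> 1 *\<^sub>R x 0)) (xb 0) (x 0)
          (lam 1) (\<beta> 1) T = (x 1, xt, n)"
        and xb1: "xb 1 = (1 - lam 1) *\<^sub>R xb 0 + lam 1 *\<^sub>R xt" and eh: "evals_h 1 = evals_h 0 + n"
      using step(2)[of 0] by auto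
    have \<gamma>1: "\<gamma> 1 = 1" and \<beta>1: "\<beta> 1 = 3 * L / \<nu>" using \<gamma>[of 1] \<beta>[of 1] lam(1) by auto
    have \<alpha>1: "\<alpha> 1 (Suc t) = 2 / (real t + 2)" and p1: "p 1 (Suc t) = real t / 2"
      and q1: "q 1 (Suc t) = 6 * M / (\<nu> * (real t + 1))" for t
      using first_call[of "Suc t"] by (simp_all add: add_ac)
    \<comment> \<open>Here \<open>\<alpha>\<close> is 1 at the first inner step, which forces
      \<open>W 0 = 0\<close>; this fits \<open>\<gamma> 1 = lam 1 = 1\<close>.\<close>
    define W :: "nat \<Rightarrow> real" where "W t = real t * (real t + 1)" for t
    have W\<alpha>: "W (Suc t) * \<alpha> 1 (Suc t) = 2 * (real t + 1)" for t
      unfolding \<alpha>1 by (simp add: W_def field_simps)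
    have Wd: "W (Suc t) * \<alpha> 1 (Suc t) = W (Suc t) - W t" for t
      unfolding W\<alpha> by (simp add: W_def algebra_simps)
    have Wp: "W (Suc t) * \<alpha> 1 (Suc t) * p 1 (Suc t) = W t" for t
      unfolding W\<alpha> p1 by (simp add: W_def field_simps)
    have Wq: "W (Suc t) * \<alpha> 1 (Suc t) * q 1 (Suc t) = 12 * M / \<nu>" for t
    proof -
      have "2 * r * (6 * M / (\<nu> * r)) = 12 * M / \<nu>" if "r > 0" for r
        using that \<nu> by simp
      from this[of "real t + 1"] show ?thesis unfolding W\<alpha> q1 by simp
    qed
    have Mq: "M * lam 1 * \<alpha> 1 (Suc t) \<le> \<nu> * q 1 (Suc t)" for t
    proof -
      have "2 * M / (real t + 2) \<le> 6 * M / (real t + 1)" using LM_pos by (intro frac_le) auto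
      then show ?thesis unfolding \<alpha>1 q1 lam(1) using \<nu> by (simp add: mult.commute)
    qed
    have mem: "xb 0 \<in> X" "x 0 \<in> X" using init x0 by auto
    note b = prox_ag_bound[OF mem refl _ _ _ _ _ _ _ _ _ _ Wd Wp Wq Mq T1 _ res]
    have "x 1 \<in> X \<and> (1 - lam 1) *\<^sub>R xb 0 + lam 1 *\<^sub>R xt \<in> X \<and> n = T \<and>
       f (xb 1) + h (xb 1) \<le> (1 - \<gamma> 1) * (f (xb 0) + h (xb 0)) + \<gamma> 1 * (f xstar + h xstar)
      + lam 1 * (\<beta> 1 + 12 * M / \<nu> / W T) * (?V (x 0) - ?V (x 1))"
      unfolding xb1
      by (intro conjI b)
        (use \<gamma>1 \<beta>1 lam(1) LM_pos \<nu> xs(1) in \<open>auto simp: W_def \<alpha>1 simp del: One_nat_def\<close>)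
    moreover have "\<beta> 1 + 12 * M / \<nu> / W T = E"
      using \<nu> unfolding \<beta>1 by (simp add: E_def W_def add_divide_distrib mult_ac)
    ultimately show "x 1 \<in> X" "xb 1 \<in> X" "evals_h 1 = T"
      "\<phi> (xb 1) \<le> \<phi> xstar + E * (?V (x 0) - ?V (x 1))"
      using eh init \<gamma>1 lam(1) by (auto simp: \<phi> xb1 simp del: One_nat_def)
  qed

  \<comment> \<open>The later calls\<close>
  have later: "x (Suc j) \<in> X \<and> xb (Suc j) \<in> X \<and> evals_h (Suc j) = evals_h j + T \<and>
    (real j + 1) * (real j + 2) * (\<phi> (xb (Suc j)) - \<phi> xstar)
      \<le> real j * (real j + 1) * (\<phi> (xb j) - \<phi> xstar) + 2 * C * (?V (x j) - ?V (x (Suc j)))"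
    if j: "j \<ge> 1" and jX: "x j \<in> X" "xb j \<in> X" for j
  proof -
    define k where "k = Suc j"
    have k: "k > 1" "k \<ge> 1" and kj: "real k = real j + 1" using j by (auto simp: k_def)
    obtain xt n where res: "prox_ag X h h' V (\<alpha> k) (p k) (q k)
          (lin_approx f f' ((1 - \<gamma> k) *\<^sub>R xb j + \<gamma> k *\<^sub>R x j)) (xb j) (x j)
          (lam k) (\<beta> k) T = (x k, xt, n)"
        and xbk: "xb k = (1 - lam k) *\<^sub>R xb j + lam k *\<^sub>R xt" and eh: "evals_h k = evals_h j + n"
      using step(2)[of j] unfolding k_def by blast
    have \<gamma>01: "0 < \<gamma> k" "\<gamma> k \<le> 1" using \<gamma>[OF k(2)] k by auto
    have gk: "(real k + 1) * \<gamma> k = 2" using \<gamma>[OF k(2)] by (simp add: field_simps)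
    have TT: "0 < real T * (real T + 3)" using T1 by simp
    have lam_pos: "0 < lam k" using lam(2)[OF k(1)] \<gamma>01 TT by simp
    have lam_le: "lam k \<le> 3 / (real k + 1)"
      using step_size_bound[OF T1, of k] by (simp add: lam(2)[OF k(1)] \<gamma>[OF k(2)])
    \<comment> \<open>This uses \<open>k \<ge> 2\<close>. At \<open>k = 1\<close> the general
      formula for \<open>lam\<close> would exceed 1, hence the separate value
      \<open>lam 1\<close>.\<close>
    have "3 / (real k + 1) \<le> 1" using k by simp
    then have lam1: "lam k \<le> 1" using lam_le by linarith
    have "lam k * (real k + 1) \<le> 3" using lam_le by (simp add: pos_le_divide_eq)
    \<comment> \<open>The source of the constants: it accounts for the 3 in \<open>\<beta>\<close>
      and, with the 2 of \<open>\<alpha>\<close>, for the 6 in \<open>q\<close>.\<close>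
    then have klam: "real k * lam k \<le> 3" using lam_pos by (simp add: algebra_simps)
    \<comment> \<open>Now \<open>W 0 = 2\<close>: \<open>\<alpha>\<close> starts at 2/3, so the
      initial point keeps some weight.\<close>
    define W :: "nat \<Rightarrow> real" where "W t = (real t + 1) * (real t + 2)" for t
    define Q where "Q = 12 * M / (\<nu> * real k)"
    have \<beta>k: "0 < \<beta> k" using \<beta>[OF k(2)] lam_pos \<gamma>01 \<nu> LM_pos k by simp
    have L\<beta>: "L * \<gamma> k \<le> \<beta> k * \<nu>"
    proof -
      have "L * \<gamma> k * (real k * lam k) \<le> L * \<gamma> k * 3"
        using LM_pos \<gamma>01 klam by (intro mult_left_mono) auto
      then show ?thesis using \<beta>[OF k(2)] lam_pos k \<nu> by (simp add: pos_le_divide_eq mult_ac)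
    qed
    \<comment> \<open>The prescribed formula for \<open>lam k\<close> is this identity solved for
      \<open>lam k\<close>.\<close>
    have lamW: "W T * \<gamma> k = lam k * (W T - W 0)"
    proof -
      have "W T - W 0 = real T * (real T + 3)" by (simp add: W_def algebra_simps)
      then show ?thesis using T1 by (simp add: lam(2)[OF k(1)] W_def)
    qed
    have \<alpha>k: "\<alpha> k (Suc t) = 2 / (real t + 3)" and pk: "p k (Suc t) = (real t + 1) / 2"
      and qk: "q k (Suc t) = 6 * M / (\<nu> * real k * (real t + 2))" for t
      using later_calls[OF k(1), of "Suc t"] by (simp_all add: add_ac)
    have Mlam: "M * lam k * \<alpha> k (Suc t) \<le> \<nu> * q k (Suc t)" for t
    proof -
      have "M * lam k * \<alpha> k (Suc t) \<le> M * (3 / real k) * (2 / (real t + 2))"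
      proof (intro mult_mono)
        show "lam k \<le> 3 / real k" using klam k by (simp add: pos_le_divide_eq mult.commute)
        show "\<alpha> k (Suc t) \<le> 2 / (real t + 2)" unfolding \<alpha>k by (intro divide_left_mono) auto
      qed (use LM_pos lam_pos in \<open>auto simp: \<alpha>k\<close>)
      also have "\<dots> = \<nu> * q k (Suc t)" using \<nu> by (simp add: qk)
      finally show ?thesis .
    qed
    have W\<alpha>: "W (Suc t) * \<alpha> k (Suc t) = 2 * (real t + 2)" for t
      by (simp add: W_def \<alpha>k field_simps)
    have Wd: "W (Suc t) * \<alpha> k (Suc t) = W (Suc t) - W t" for t
      unfolding W\<alpha> by (simp add: W_def algebra_simps)
    have Wp: "W (Suc t) * \<alpha> k (Suc t) * p k (Suc t) = W t" for t
      unfolding W\<alpha> by (simp add: W_def pk)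
    have Wq: "W (Suc t) * \<alpha> k (Suc t) * q k (Suc t) = Q" for t
    proof -
      have "2 * r * (6 * M / (\<nu> * real k * r)) = Q" if "r > 0" for r
        using that \<nu> k by (simp add: Q_def)
      from this[of "real t + 2"] show ?thesis unfolding W\<alpha> qk by simp
    qed
    note b = prox_ag_bound[OF jX(2,1) refl less_imp_le[OF \<gamma>01(1)] \<gamma>01(2) less_imp_le[OF lam_pos] lam1
        \<beta>k L\<beta> _ _ _ _ Wd Wp Wq Mlam T1 lamW res]
    have "x k \<in> X \<and> (1 - lam k) *\<^sub>R xb j + lam k *\<^sub>R xt \<in> X \<and> n = T \<and>
       f (xb k) + h (xb k) \<le> (1 - \<gamma> k) * (f (xb j) + h (xb j)) + \<gamma> k * (f xstar + h xstar)
      + lam k * (\<beta> k + Q / W T) * (?V (x j) - ?V (x k))"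
      unfolding xbk by (intro conjI b) (auto simp: \<alpha>k W_def xs(1))
    then have kX: "x k \<in> X" "xb k \<in> X" "n = T"
      and "\<phi> (xb k) \<le> (1 - \<gamma> k) * \<phi> (xb j) + \<gamma> k * \<phi> xstar
        + lam k * (\<beta> k + Q / W T) * (?V (x j) - ?V (x k))"
      by (simp_all add: xbk \<phi>)
    \<comment> \<open>Since \<open>k (k + 1) (1 - \<gamma>\<^sub>k) = (k - 1) k\<close>, this factor
      makes the gaps telescope over \<open>k\<close>.\<close>
    then have "real k * (real k + 1) * \<phi> (xb k) \<le> real k * (real k + 1) *
       ((1 - \<gamma> k) * \<phi> (xb j) + \<gamma> k * \<phi> xstar + lam k * (\<beta> k + Q / W T) * (?V (x j) - ?V (x k)))"
      by (intro mult_left_mono) auto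
    also have "\<dots> = (real k * (real k + 1) * (1 - \<gamma> k)) * \<phi> (xb j) + (real k * (real k + 1) * \<gamma> k) * \<phi> xstar
       + (real k * (real k + 1) * (lam k * (\<beta> k + Q / W T))) * (?V (x j) - ?V (x k))"
      by (simp only: distrib_left distrib_right mult_ac add_ac)
    also have "real k * (real k + 1) * \<gamma> k = 2 * real k"
      by (simp add: mult.assoc gk)
    also have "real k * (real k + 1) * (1 - \<gamma> k) = real k * real j"
      unfolding mult.assoc using gk kj by (simp add: right_diff_distrib)
    \<comment> \<open>The factor \<open>lam k\<close> cancels in both terms and leaves
      \<open>\<gamma> k / k\<close>, so the product no longer depends on \<open>k\<close>.\<close>
    also have "real k * (real k + 1) * (lam k * (\<beta> k + Q / W T)) = 2 * C"
    proof -
      have "lam k * \<beta> k = 3 * L * \<gamma> k / (\<nu> * real k)"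
        using \<beta>[OF k(2)] lam_pos by simp
      moreover have "lam k / W T = \<gamma> k / (real T * (real T + 3))"
        by (simp add: lam(2)[OF k(1)] W_def)
      then have "lam k * (Q / W T) = Q * (\<gamma> k / (real T * (real T + 3)))"
        by (metis mult.commute times_divide_eq_left)
      ultimately have "lam k * (\<beta> k + Q / W T) = \<gamma> k * C / real k"
        using \<nu> k by (simp add: distrib_left Q_def C_def add_divide_distrib mult_ac)
      then have "real k * (real k + 1) * (lam k * (\<beta> k + Q / W T)) = ((real k + 1) * \<gamma> k) * C"
        using k by simp
      then show ?thesis by (simp add: gk)
    qed
    finally have "real k * (real k + 1) * (\<phi> (xb k) - \<phi> xstar)
      \<le> real j * real k * (\<phi> (xb j) - \<phi> xstar) + 2 * C * (?V (x j) - ?V (x k))"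
      by (simp add: kj algebra_simps)
    with kX eh show ?thesis by (simp add: k_def algebra_simps)
  qed

  \<comment> \<open>Summation over the outer iterations\<close>
  have CE: "C \<le> E" "0 \<le> C"
  proof -
    have "12 * M / (real T * (real T + 3)) \<le> 12 * M / (real T * (real T + 1))"
      using T1 LM_pos by (intro divide_left_mono mult_left_mono) auto
    then show "C \<le> E" unfolding C_def E_def using \<nu> by (intro divide_right_mono) auto
    show "0 \<le> C" unfolding C_def using LM_pos \<nu> by simp
  qed
  \<comment> \<open>\<open>M \<le> L T (T + 1)\<close> bounds the second term of \<open>E\<close> by
    \<open>12 L / \<nu>\<close>; then 15 = 3 + 12, and the weight 2 at \<open>k = 1\<close> gives
    the final 30.\<close>
  have E: "E \<le> 15 * L / \<nu>"
  proof -
    have "0 \<le> L * real T" using LM_pos by simp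
    then have "M \<le> L * (real T * (real T + 1))"
      using MT by (simp add: power2_eq_square algebra_simps)
    then have "12 * M / (real T * (real T + 1)) \<le> 12 * L"
      using T1 by (simp add: pos_divide_le_eq)
    then show ?thesis unfolding E_def using \<nu> by (intro divide_right_mono) auto
  qed
  have V0: "0 \<le> ?V x0" by (rule V_nonneg[OF x0 xs(1)])
  have main: "x N \<in> X \<and> xb N \<in> X \<and> evals_h N = N * T \<and>
      real N * (real N + 1) * (\<phi> (xb N) - \<phi> xstar) + 2 * C * ?V (x N) \<le> 30 * L / \<nu> * ?V x0"
    if "N \<ge> 1" for N
    using that
  proof (induction N rule: dec_induct)
    case base
    \<comment> \<open>Lowering the coefficient of \<open>V (x 1) xstar\<close> from
      \<open>2 * E\<close> to \<open>2 * C\<close> matches it to the later steps, so that the sum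
      telescopes.\<close>
    have "2 * C * ?V (x 1) \<le> 2 * E * ?V (x 1)"
      using CE V_nonneg[OF first(1) xs(1)] by (intro mult_right_mono) auto
    moreover have "2 * E * ?V x0 \<le> 2 * (15 * L / \<nu>) * ?V x0"
      using E V0 by (intro mult_right_mono) auto
    moreover have "2 * (\<phi> (xb 1) - \<phi> xstar) \<le> 2 * E * ?V x0 - 2 * E * ?V (x 1)"
      using first(4) init by (simp add: algebra_simps)
    ultimately show ?case using first by simp
  next
    case (step j)
    with later[of j] show ?case by (simp add: algebra_simps)
  qed
  have evals_f: "evals_f N = N" for N
    by (induction N) (simp_all add: init step)
  have evals_h: "evals_h N = N * T" for N
    using main[of N] init by (cases "N = 0") auto

  \<comment> \<open>From the convergence rate to evaluation counts\<close>
  have Nf_sq: "Nf\<^sup>2 = 30 * L * ?V x0 / (\<nu> * \<epsilon>)" and Nf0: "0 \<le> Nf"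
    unfolding Nf using LM_pos \<nu> \<epsilon> V0 by simp_all
  have Nh': "Nh = (sqrt (M / L) + 1) * Nf"
  proof -
    have "30 * M * ?V x0 / (\<nu> * \<epsilon>) = (M / L) * (30 * L * ?V x0 / (\<nu> * \<epsilon>))"
      using LM_pos by simp
    then have "sqrt (30 * M * ?V x0 / (\<nu> * \<epsilon>)) = sqrt (M / L) * Nf"
      unfolding Nf real_sqrt_mult[symmetric] by (rule arg_cong)
    then show ?thesis unfolding Nh by (simp add: Nf[symmetric] distrib_right)
  qed
  have sol: "eps_solution X \<phi> \<epsilon> (xb N)" if N: "Nf \<le> real N" for N
  proof (cases "N = 0")
    \<comment> \<open>The rate starts at \<open>N = 1\<close>. For \<open>N = 0\<close> the
      hypothesis forces \<open>Nf = 0\<close>, so \<open>V x0 xstar = 0\<close> and the starting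
      point is already \<open>xstar\<close>.\<close>
    case True
    then have "Nf\<^sup>2 = 0" using N Nf0 by simp
    then have "?V x0 = 0" using Nf_sq LM_pos \<nu> \<epsilon> by simp
    then have "(nrm (x0 - xstar))\<^sup>2 \<le> 0"
      using prox_function_ge[OF V x0 xs(1)] \<nu> by (simp add: mult_le_0_iff)
    then have "nrm (x0 - xstar) = 0" by simp
    then have "x0 = xstar" using nrm by (simp add: is_norm_def)
    then show ?thesis using True init x0 inf \<epsilon> by (simp add: eps_solution_def)
  next
    case False
    then have N1: "N \<ge> 1" by simp
    note m = main[OF N1]
    have "0 \<le> 2 * C * ?V (x N)" using CE V_nonneg[OF _ xs(1)] m by simp
    moreover have "30 * L / \<nu> * ?V x0 = \<epsilon> * Nf\<^sup>2" using Nf_sq \<epsilon> \<nu> by simp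
    moreover have "\<epsilon> * Nf\<^sup>2 \<le> \<epsilon> * (real N * (real N + 1))"
    proof (rule mult_left_mono)
      have "Nf\<^sup>2 \<le> (real N)\<^sup>2" using N Nf0 by (intro power_mono) auto
      then show "Nf\<^sup>2 \<le> real N * (real N + 1)" by (simp add: power2_eq_square algebra_simps)
    qed (use \<epsilon> in simp)
    ultimately have "real N * (real N + 1) * (\<phi> (xb N) - \<phi> xstar) \<le> \<epsilon> * (real N * (real N + 1))"
      using m by linarith
    then have "real N * (real N + 1) * (\<phi> (xb N) - \<phi> xstar) \<le> real N * (real N + 1) * \<epsilon>"
      by (simp only: mult.commute)
    then have "\<phi> (xb N) - \<phi> xstar \<le> \<epsilon>" using N1 by (subst (asm) mult_le_cancel_left_pos) auto
    then show ?thesis using m inf by (simp add: eps_solution_def)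
  qed
  show ?thesis
  proof (intro conjI allI impI)
    fix N assume "Nf \<le> real (evals_f N) \<or> Nh \<le> real (evals_h N)"
    then show "eps_solution X \<phi> \<epsilon> (xb N)"
    proof
      assume "Nh \<le> real (evals_h N)"
      \<comment> \<open>The right side is \<open>Nh\<close>, so \<open>N * T \<ge> Nh\<close>
        implies \<open>N \<ge> Nf\<close>.\<close>
      moreover have "real T * Nf \<le> (sqrt (M / L) + 1) * Nf" using T_le Nf0 by (intro mult_right_mono)
      ultimately have "real T * Nf \<le> real T * real N" by (simp add: evals_h Nh' mult.commute)
      then show ?thesis using T1 sol by simp
    qed (use sol evals_f in simp)
  next
    \<comment> \<open>Rounding up adds the fraction \<open>\<lceil>Nf\<rceil> - Nf\<close> of an
      outer iteration, charged at \<open>T\<close> evaluations of \<open>h'\<close> per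
      iteration.\<close>
    define N where "N = nat \<lceil>Nf\<rceil>"
    have N: "real N = of_int \<lceil>Nf\<rceil>" using Nf0 by (simp add: N_def)
    then have "eps_solution X \<phi> \<epsilon> (xb N)" by (intro sol) simp
    moreover have "real (evals_h N) \<le> Nh + (of_int \<lceil>Nf\<rceil> - Nf) * real T"
    proof -
      have "Nf * real T \<le> Nf * (sqrt (M / L) + 1)" using T_le Nf0 by (intro mult_left_mono)
      then show ?thesis by (simp add: evals_h N[symmetric] Nh' algebra_simps)
    qed
    ultimately show "\<exists>N. eps_solution X \<phi> \<epsilon> (xb N) \<and> real (evals_f N) \<le> of_int \<lceil>Nf\<rceil> \<and>
        real (evals_h N) \<le> Nh + (of_int \<lceil>Nf\<rceil> - Nf) * real T"
      by (intro exI[of _ N]) (simp add: evals_f N)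
  qed
qed

end
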